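(* Let $p_0$ be the critical point for the existence of a $0$-path in $\mathbb L$ with i.i.d. Bernoulli($p$) edge costs. Then $p_0\in(0,1)$, and for any $p\in[0,1]$ with $p<p_0$, $\mathbb P_p$-almost surely there exists a $0$-path.
   Context: Graph. $\mathbb L=\{(x,y)\in\mathbb Z^2: x+y \text{ is even}\}$, with an edge between two points exactly when they are at Euclidean distance $\sqrt2$. $E$ is the set of (non-oriented) edges. Each edge $e$ carries a cost $c(e)$; the $(c(e))_{e\in E}$ are i.i.d. Bernoulli random variables with parameter $p\in[0,1]$; the law is $\mathbb P_p$. $0$-squares and $0$-paths. The squares (faces) of $\mathbb L$ are identified with their centers, i.e. the points $(x,y)\in\mathbb Z^2$ with $x+y$ odd; the square centered at $(x,y)$ has corners $(x\pm1,y),(x,y\pm1)$ and is composed of the four edges of $\mathbb L$ joining these corners cyclically. A square is a $0$-square if its four edges all have cost $0$. A $0$-path is an infinite (in both directions) horizontal path of $0$-squares, i.e. a sequence of centers $(i,y_i)_{i\in\mathbb Z}$ with $i+y_i$ odd and $|y_{i+1}-y_i|=1$ for all $i\in\mathbb Z$ (consecutive squares share an edge), such that every square centered at $(i,y_i)$ is a $0$-square. The critical point is $p_0=\sup\{p\in[0,1]:\mathbb P_p(\text{there exists a }0\text{-path})>0\}$. *)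

theory Defs
  imports "HOL-Probability.Probability"
begin

type_synonym point = "int \<times> int"

definition lattice_points :: "point set" where
  "lattice_points = {(x, y). even (x + y)}"

text \<open>The Euclidean distance is the library's distance on \<open>real \<times> real\<close>.\<close>

definition euclid_dist :: "point \<Rightarrow> point \<Rightarrow> real" where
  "euclid_dist u v = dist (real_of_int (fst u), real_of_int (snd u))
                          (real_of_int (fst v), real_of_int (snd v))"

definition lattice_edges :: "point set set" where
  "lattice_edges = {{u, v} | u v. u \<in> lattice_points \<and> v \<in> lattice_points \<and> euclid_dist u v = sqrt 2}"

text \<open>A Bernoulli cost equals 1 with probability \<open>p\<close> and 0 with probability \<open>1 - p\<close>.
  For \<open>p\<close> outside \<open>[0,1]\<close> the library clamps the parameter; only \<open>p \<in> [0,1]\<close> is ever used.\<close>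

definition cost_law :: "real \<Rightarrow> (point set \<Rightarrow> nat) measure" where
  "cost_law p = (\<Pi>\<^sub>M e\<in>lattice_edges. measure_pmf (map_pmf of_bool (bernoulli_pmf p)))"

text \<open>Squares are identified with their centres, the points with odd coordinate sum.\<close>

definition square_centers :: "point set" where
  "square_centers = {(x, y). odd (x + y)}"

fun square_edges :: "point \<Rightarrow> point set set" where
  "square_edges (x, y) =
     {{(x + 1, y), (x, y + 1)}, {(x, y + 1), (x - 1, y)},
      {(x - 1, y), (x, y - 1)}, {(x, y - 1), (x + 1, y)}}"

definition zero_square :: "(point set \<Rightarrow> nat) \<Rightarrow> point \<Rightarrow> bool" where
  "zero_square c z \<longleftrightarrow> z \<in> square_centers \<and> (\<forall>e\<in>square_edges z. c e = 0)"

text \<open>The function \<open>y\<close> encodes the sequence of centres \<open>(i, y i)\<close>, \<open>i \<in> \<int>\<close>.\<close>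

definition zero_path :: "(point set \<Rightarrow> nat) \<Rightarrow> (int \<Rightarrow> int) \<Rightarrow> bool" where
  "zero_path c y \<longleftrightarrow> (\<forall>i. \<bar>y (i + 1) - y i\<bar> = 1 \<and> zero_square c (i, y i))"

definition p0 :: real where
  "p0 = Sup {p \<in> {0..1}. \<P>(c in cost_law p. \<exists>y. zero_path c y) > 0}"

end

theory Submission
  imports Defs "HOL-Library.Transitive_Closure_Table"
begin

text \<open>
  For \<open>p > 1/2\<close> the expected number of 0-paths of length \<open>n\<close> from a given square is at most
  \<open>(2 (1 - p))^n\<close>, which tends to 0; hence \<open>p\<^sub>0 \<le> 1/2\<close>.

  For small \<open>p\<close> the argument of Lipschitz percolation applies: start from the squares of height at
  most 0 and repeatedly move up by 2 into a square that is not a 0-square, or diagonally down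
  to any neighbour. If some square is not reached, then the lowest unreached squares of the columns
  form a 0-path, and a union bound over self-avoiding walks shows that \<open>(0, 1)\<close> is unreached with
  positive probability.

  If \<open>p < p\<^sub>0\<close>, then a coupling gives a positive probability at \<open>p\<close>, so by vertical translation
  invariance 0-paths cross the axis \<open>x = 0\<close> at arbitrarily high points with positive probability. This
  last event is a tail event, because a 0-path through \<open>(0, b)\<close> stays in the cone
  \<open>\<bar>x\<bar> + y \<ge> b\<close>; so it has probability 1.
\<close>

section \<open>Finite and infinite walks\<close>

text \<open>The index counts steps, so the lists have \<open>n + 1\<close> entries. \<open>N\<close>
  is a parameter because two kinds of walks occur: horizontal ones (\<open>nxt d\<close>) and
  backward ones (\<open>nbrs\<close>).\<close>

fun walks :: "('a \<Rightarrow> 'a set) \<Rightarrow> nat \<Rightarrow> 'a \<Rightarrow> 'a list set" where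
  "walks N 0 z = {[z]}"
| "walks N (Suc n) z = (\<Union>w\<in>N z. (#) z ` walks N n w)"

lemma walks_start: "xs \<in> walks N n z \<Longrightarrow> \<exists>ys. xs = z # ys"
  by (cases n) auto

lemma length_walks: "xs \<in> walks N n z \<Longrightarrow> length xs = Suc n"
  by (induction n arbitrary: z xs) auto

lemma finite_walks:
  assumes "\<And>z. finite (N z)"
  shows "finite (walks N n z)"
  by (induction n arbitrary: z) (auto simp: assms)

lemma card_walks_le:
  assumes fin: "\<And>z. finite (N z)" and card: "\<And>z. card (N z) \<le> k"
  shows "card (walks N n z) \<le> k ^ n"
proof (induction n arbitrary: z)
  case (Suc n)
  have "card (walks N (Suc n) z) \<le> (\<Sum>w\<in>N z. card ((#) z ` walks N n w))"
    using card_UN_le[OF fin] by simp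
  also have "\<dots> \<le> (\<Sum>w\<in>N z. k ^ n)"
    by (intro sum_mono order_trans[OF card_image_le] Suc.IH finite_walks fin)
  also have "\<dots> \<le> k ^ Suc n"
    using card[of z] by (simp add: mult_right_mono)
  finally show ?case .
qed simp

lemma walks_of_rtrancl_path:
  assumes "rtrancl_path r z xs w" and "\<And>u v. r u v \<Longrightarrow> v \<in> N u"
  shows "z # xs \<in> walks N (length xs) z" and "last (z # xs) = w"
  using assms by (induction rule: rtrancl_path.induct) auto

lemma walk_prefix:
  assumes "\<exists>xs\<in>walks N (Suc n) z. \<forall>w\<in>set xs. P w"
  shows "\<exists>xs\<in>walks N n z. \<forall>w\<in>set xs. P w"
  using assms
proof (induction n arbitrary: z)
  case (Suc n)
  then obtain w xs where w: "w \<in> N z" "xs \<in> walks N (Suc n) w" and xs: "P z" "\<forall>u\<in>set xs. P u"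
    unfolding walks.simps(2)[of N "Suc n"] by (auto simp del: walks.simps)
  from Suc.IH[of w] w xs obtain ys where "ys \<in> walks N n w" "\<forall>u\<in>set ys. P u"
    by blast
  with w xs show ?case
    by (intro bexI[of _ "z # ys"]) auto
qed auto

lemma walk_prefix_le:
  assumes "\<exists>xs\<in>walks N n z. \<forall>w\<in>set xs. P w" and "m \<le> n"
  shows "\<exists>xs\<in>walks N m z. \<forall>w\<in>set xs. P w"
  using assms(2,1)
proof (induction rule: dec_induct)
  case (step n)
  from step.IH walk_prefix[OF step.prems] show ?case .
qed

text \<open>Call a point good if walks inside \<open>P\<close> of every length start there.
  Neighbourhoods are finite, so a good point has a good neighbour, and dependent choice yields the
  infinite walk.\<close>

lemma infinite_walk_Konig:
  assumes fin: "\<And>z. finite (N z)"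
    and walks: "\<And>n. \<exists>xs\<in>walks N n z. \<forall>w\<in>set xs. P w"
  obtains f where "f 0 = z" "\<And>i. f (Suc i) \<in> N (f i)" "\<And>i::nat. P (f i)"
proof -
  define G where "G z \<longleftrightarrow> (\<forall>n. \<exists>xs\<in>walks N n z. \<forall>w\<in>set xs. P w)" for z
  have G_P: "P z" if "G z" for z
    using that[unfolded G_def, rule_format, of 0] by simp
  have G_step: "\<exists>w\<in>N z. G w" if "G z" for z
  proof (rule ccontr)
    assume "\<not> (\<exists>w\<in>N z. G w)"
    then obtain m where m: "\<And>w. w \<in> N z \<Longrightarrow> \<not> (\<exists>xs\<in>walks N (m w) w. \<forall>u\<in>set xs. P u)"
      unfolding G_def by metis
    \<comment> \<open>The finitely many failing lengths \<open>m w\<close> have a common bound; a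
      walk with \<open>Suc b\<close> steps from \<open>z\<close> then contradicts one of
      them.\<close>
    obtain b where b: "\<And>w. w \<in> N z \<Longrightarrow> m w \<le> b"
      using finite_nat_set_iff_bounded_le[of "m ` N z"] fin by auto
    from that obtain xs where "xs \<in> walks N (Suc b) z" "\<forall>u\<in>set xs. P u"
      unfolding G_def by blast
    then obtain w ys where w: "w \<in> N z" and ys: "ys \<in> walks N b w" "\<forall>u\<in>set ys. P u"
      by auto
    have "\<exists>xs\<in>walks N (m w) w. \<forall>u\<in>set xs. P u"
      by (rule walk_prefix_le[of N b]) (use ys b[OF w] in auto)
    with m[OF w] show False ..
  qed
  have "\<exists>f. \<forall>i. (G (f i) \<and> (i = 0 \<longrightarrow> f i = z)) \<and> f (Suc i) \<in> N (f i)"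
  proof (rule dependent_nat_choice)
    show "\<exists>x. G x \<and> (0 = (0::nat) \<longrightarrow> x = z)"
      using walks unfolding G_def by blast
  qed (use G_step in blast)
  then show ?thesis
    using that G_P by blast
qed

section \<open>Two-sided paths as pairs of one-sided walks\<close>

definition nxt :: "int \<Rightarrow> point \<Rightarrow> point set" where
  "nxt d z = {(fst z + d, snd z + 1), (fst z + d, snd z - 1)}"

lemma finite_nxt [simp]: "finite (nxt d z)"
  by (simp add: nxt_def)

lemma card_nxt_le: "card (nxt d z) \<le> 2"
  by (simp add: nxt_def card_insert_if)

text \<open>Reduces a path to countably many conditions on finite walks, which serves both
  measurability and counting. The converse uses Konig's lemma to the right and to the left and glues
  the halves at column 0.\<close>

lemma ex_zero_path_iff_walks:
  "(\<exists>y. zero_path c y \<and> y 0 = b) \<longleftrightarrow>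
   (\<forall>d\<in>{1, -1}. \<forall>n. \<exists>xs\<in>walks (nxt d) n (0, b). \<forall>w\<in>set xs. zero_square c w)"
proof (intro iffI ballI allI)
  fix d :: int and n :: nat
  assume "\<exists>y. zero_path c y \<and> y 0 = b" and d: "d \<in> {1, -1}"
  then obtain y where y: "zero_path c y" and y0: "y 0 = b"
    by blast
  have step: "(i + d, y (i + d)) \<in> nxt d (i, y i)" for i
  proof -
    have "\<bar>y (i + 1) - y i\<bar> = 1" "\<bar>y i - y (i - 1)\<bar> = 1"
      using y unfolding zero_path_def by (blast, metis diff_add_cancel)
    with d show ?thesis
      by (auto simp: nxt_def)
  qed
  have "\<exists>xs\<in>walks (nxt d) n (i, y i). \<forall>w\<in>set xs. zero_square c w" for i
  proof (induction n arbitrary: i)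
    case 0
    then show ?case using y by (simp add: zero_path_def)
  next
    case (Suc n)
    obtain xs where "xs \<in> walks (nxt d) n (i + d, y (i + d))" "\<forall>w\<in>set xs. zero_square c w"
      using Suc.IH by blast
    with step[of i] y show ?case
      by (intro bexI[of _ "(i, y i) # xs"]) (auto simp: zero_path_def)
  qed
  from this[of 0] show "\<exists>xs\<in>walks (nxt d) n (0, b). \<forall>w\<in>set xs. zero_square c w"
    by (simp add: y0)
next
  assume *: "\<forall>d\<in>{1, -1}. \<forall>n. \<exists>xs\<in>walks (nxt d) n (0, b). \<forall>w\<in>set xs. zero_square c w"
  have half: "\<exists>g. g 0 = b \<and> (\<forall>i. \<bar>g (Suc i) - g i\<bar> = 1 \<and> zero_square c (d * int i, g i))"
    if d: "d \<in> {1, -1}" for d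
  proof -
    obtain f where f: "f 0 = (0, b)" "\<And>i. f (Suc i) \<in> nxt d (f i)" "\<And>i. zero_square c (f i)"
      by (rule infinite_walk_Konig[of "nxt d" "(0, b)" "zero_square c"]) (use * d in auto)
    have fst: "fst (f i) = d * int i" for i
    proof (induction i)
      case (Suc i)
      then show ?case using f(2)[of i] by (auto simp: nxt_def algebra_simps)
    qed (simp add: f(1))
    have "zero_square c (d * int i, snd (f i))" for i
      using f(3)[of i] fst[of i] by (metis prod.collapse)
    moreover have "\<bar>snd (f (Suc i)) - snd (f i)\<bar> = 1" for i
      using f(2)[of i] by (auto simp: nxt_def)
    ultimately show ?thesis
      using f(1) by (intro exI[of _ "\<lambda>i. snd (f i)"]) auto
  qed
  obtain g h where g: "g 0 = b" "\<And>i. \<bar>g (Suc i) - g i\<bar> = 1" "\<And>i. zero_square c (int i, g i)"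
    and h: "h 0 = b" "\<And>i. \<bar>h (Suc i) - h i\<bar> = 1" "\<And>i. zero_square c (- int i, h i)"
    using half[of 1] half[of "-1"] by auto
  define y where "y i = (if 0 \<le> i then g (nat i) else h (nat (- i)))" for i
  have "\<bar>y (i + 1) - y i\<bar> = 1" for i
  proof (cases "0 \<le> i")
    case True
    then show ?thesis
      using g(2)[of "nat i"] by (simp add: y_def nat_add_distrib)
  next
    case False
    then have "nat (- i) = Suc (nat (- (i + 1)))"
      by simp
    \<comment> \<open>For \<open>i = -1\<close> the right neighbour \<open>y 0\<close> comes from
      \<open>g\<close>, so \<open>g 0 = h 0\<close> is needed.\<close>
    then show ?thesis
      using h(2)[of "nat (- (i + 1))"] False g(1) h(1)
      by (cases "i = -1") (auto simp: y_def abs_minus_commute)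
  qed
  moreover have "zero_square c (i, y i)" for i
    using g(3)[of "nat i"] h(3)[of "nat (- i)"] by (auto simp: y_def)
  ultimately show "\<exists>y. zero_path c y \<and> y 0 = b"
    using g(1) by (intro exI[of _ y]) (auto simp: zero_path_def y_def)
qed


text \<open>Every step moves one column in direction \<open>d\<close> and one unit vertically. The
  cone gives self-avoidance and later shows that a path through a high point of column 0 stays away
  from a given finite set of edges.\<close>

lemma walks_nxt_cone:
  assumes "xs \<in> walks (nxt d) n z" "w \<in> set xs" "d \<in> {1, -1}"
  shows "\<bar>snd w - snd z\<bar> \<le> d * (fst w - fst z)"
  using assms
proof (induction n arbitrary: z xs)
  case (Suc n)
  then obtain u ys where u: "u \<in> nxt d z" "ys \<in> walks (nxt d) n u" and xs: "xs = z # ys"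
    by auto
  show ?case
  proof (cases "w = z")
    case False
    then have "\<bar>snd w - snd u\<bar> \<le> d * (fst w - fst u)"
      using Suc xs u by auto
    then show ?thesis
      using u(1) Suc.prems(3) by (auto simp: nxt_def)
  qed simp
qed auto

lemma distinct_walks_nxt:
  assumes "xs \<in> walks (nxt d) n z" "d \<in> {1, -1}"
  shows "distinct xs"
  using assms
proof (induction n arbitrary: z xs)
  case (Suc n)
  then obtain u ys where u: "u \<in> nxt d z" "ys \<in> walks (nxt d) n u" and xs: "xs = z # ys"
    by auto
  have "z \<notin> set ys"
    using walks_nxt_cone[OF u(2) _ Suc.prems(2), of z] u(1) Suc.prems(2) by (auto simp: nxt_def)
  with Suc u xs show ?case by auto
qed auto

section \<open>The lowest unreachable squares form a 0-path\<close>

text \<open>The possible predecessors of \<open>z\<close> in the exploration: the first undoes a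
  move up by 2, the others undo diagonal moves down. In \<open>bstep\<close> badness is asked of
  \<open>z\<close>, the square entered by the move up.\<close>

definition nbrs :: "point \<Rightarrow> point set" where
  "nbrs z = {(fst z, snd z - 2), (fst z + 1, snd z + 1), (fst z - 1, snd z + 1)}"

definition bstep :: "(point \<Rightarrow> bool) \<Rightarrow> point \<Rightarrow> point \<Rightarrow> bool" where
  "bstep bad z w \<longleftrightarrow> w \<in> nbrs z \<and> (w = (fst z, snd z - 2) \<longrightarrow> bad z)"

text \<open>Walks are followed backwards: \<open>rch bad z\<close> says that \<open>z\<close> is reached from height at most 0.\<close>

definition rch :: "(point \<Rightarrow> bool) \<Rightarrow> point \<Rightarrow> bool" where
  "rch bad z \<longleftrightarrow> (\<exists>w. snd w \<le> 0 \<and> (bstep bad)\<^sup>*\<^sup>* z w)"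

lemma rch_nonpos: "y \<le> 0 \<Longrightarrow> rch bad (x, y)"
  by (auto simp: rch_def intro!: exI[of _ "(x, y)"])

lemma rch_bstep: "bstep bad z w \<Longrightarrow> rch bad w \<Longrightarrow> rch bad z"
  unfolding rch_def by (meson converse_rtranclp_into_rtranclp)

lemma rch_up: "rch bad (x, y - 2) \<Longrightarrow> bad (x, y) \<Longrightarrow> rch bad (x, y)"
  by (erule rch_bstep[rotated]) (auto simp: bstep_def nbrs_def)

lemma rch_down:
  assumes "rch bad (x, y)"
  shows "rch bad (x + 1, y - 1)" "rch bad (x - 1, y - 1)"
  by (rule rch_bstep[OF _ assms], simp add: bstep_def nbrs_def)+

text \<open>Unreached squares are closed under diagonal moves up, so from \<open>(0, 1)\<close> they
  spread to every column, and the lowest heights of adjacent columns differ by at most 1, hence by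
  exactly 1 by parity. A lowest unreached square is a 0-square, for otherwise it would be reached
  from the square 2 below it.\<close>

lemma zero_path_if_not_rch:
  assumes "\<not> rch (\<lambda>z. \<not> zero_square c z) (0, 1)"
  shows "\<exists>y. zero_path c y"
proof -
  let ?R = "rch (\<lambda>z. \<not> zero_square c z)"
  \<comment> \<open>Natural heights allow \<open>LEAST\<close>; nothing is lost, since squares of
    height at most 0 are reached.\<close>
  define Q where "Q x k \<longleftrightarrow> odd (x + int k) \<and> \<not> ?R (x, int k)" for x k
  have up: "\<not> ?R (x + 1, y + 1)" "\<not> ?R (x - 1, y + 1)" if "\<not> ?R (x, y)" for x y
    using rch_down(1)[of _ "x - 1" "y + 1"] rch_down(2)[of _ "x + 1" "y + 1"] that by auto
  have Q_step: "Q (x + 1) (Suc k)" "Q (x - 1) (Suc k)" if "Q x k" for x k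
    using up[of x "int k"] that by (auto simp: Q_def add.commute[of 1])
  have Q_pos: "Q (int m) (Suc m) \<and> Q (- int m) (Suc m)" for m
  proof (induction m)
    case 0
    then show ?case using assms by (simp add: Q_def)
  next
    case (Suc m)
    then show ?case
      using Q_step(1)[of "int m" "Suc m"] Q_step(2)[of "- int m" "Suc m"]
      by (simp add: algebra_simps minus_diff_commute)
  qed
  have ex: "\<exists>k. Q x k" for x
    using Q_pos[of "nat \<bar>x\<bar>"] by (cases "0 \<le> x") auto
  define h where "h x = (LEAST k. Q x k)" for x
  have Qh: "Q x (h x)" for x
    unfolding h_def using ex by (rule LeastI_ex)
  have below: "?R (x, y)" if "y < int (h x)" "odd (x + y)" for x y
  proof (cases "y \<le> 0")
    case False
    then have "\<not> Q x (nat y)"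
      using that unfolding h_def by (intro not_less_Least) auto
    then show ?thesis
      using False that by (auto simp: Q_def)
  qed (rule rch_nonpos)
  have h_le: "h x \<le> Suc (h (x + 1))" "h (x + 1) \<le> Suc (h x)" for x
    using Q_step(2)[OF Qh[of "x + 1"]] Q_step(1)[OF Qh[of x]]
    unfolding h_def by (auto intro: Least_le)
  have "zero_path c (\<lambda>x. int (h x))"
    unfolding zero_path_def
  proof (intro allI conjI)
    fix x
    have "odd (x + int (h x))" "odd (x + 1 + int (h (x + 1)))"
      using Qh unfolding Q_def by blast+
    with h_le[of x] show "\<bar>int (h (x + 1)) - int (h x)\<bar> = 1"
      by presburger
    have "?R (x, int (h x) - 2)"
      using Qh[of x] by (intro below) (auto simp: Q_def)
    then show "zero_square c (x, int (h x))"
      using rch_up Qh[of x] unfolding Q_def by blast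
  qed
  then show ?thesis by blast
qed

text \<open>Records the squares from which a backward walk steps down by 2, the ones that
  \<open>bstep\<close> requires to be bad.\<close>

fun downs :: "point list \<Rightarrow> point list" where
  "downs (z # w # xs) =
     (if w = (fst z, snd z - 2) then z # downs (w # xs) else downs (w # xs))"
| "downs _ = []"

lemma set_downs_subset: "set (downs xs) \<subseteq> set xs"
  by (induction xs rule: downs.induct) auto

lemma distinct_downs: "distinct xs \<Longrightarrow> distinct (downs xs)"
proof (induction xs rule: downs.induct)
  case (1 z w xs)
  then show ?case using set_downs_subset[of "w # xs"] by auto
qed auto

text \<open>A step changes the height by 1 or by -2 = 1 - 3, and \<open>downs\<close> counts the
  second kind.\<close>

lemma height_walks_nbrs:
  "xs \<in> walks nbrs n z \<Longrightarrow> snd (last xs) = snd z + int n - 3 * int (length (downs xs))"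
proof (induction n arbitrary: z xs)
  case (Suc n)
  then obtain u ys where u: "u \<in> nbrs z" "ys \<in> walks nbrs n u" and xs: "xs = z # ys"
    by auto
  obtain vs where "ys = u # vs"
    using walks_start[OF u(2)] by auto
  with Suc.IH[OF u(2)] u(1) xs show ?case
    by (auto simp: nbrs_def)
qed auto

lemma walks_nbrs_centers:
  "xs \<in> walks nbrs n z \<Longrightarrow> z \<in> square_centers \<Longrightarrow> set xs \<subseteq> square_centers"
proof (induction n arbitrary: z xs)
  case (Suc n)
  then obtain u ys where u: "u \<in> nbrs z" "ys \<in> walks nbrs n u" and xs: "xs = z # ys"
    by auto
  then have "u \<in> square_centers"
    using Suc.prems(2) by (auto simp: nbrs_def square_centers_def)
  with Suc.IH[OF u(2)] Suc.prems(2) xs show ?case by auto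
qed auto

lemma downs_bad:
  "rtrancl_path (bstep bad) z xs w \<Longrightarrow> \<forall>u\<in>set (downs (z # xs)). bad u"
  by (induction rule: rtrancl_path.induct) (auto simp: bstep_def)

text \<open>Loops are erased from a backward walk to height at most 0, and the height formula gives
  the inequality. Distinctness makes the bad squares distinct, so that their number enters the union
  bound.\<close>

lemma rch_imp_bad_walk:
  assumes "rch bad z"
  obtains n xs where "xs \<in> walks nbrs n z" "distinct xs" "snd z + int n \<le> 3 * int (length (downs xs))"
    "\<forall>u\<in>set (downs xs). bad u"
proof -
  obtain w xs where "snd w \<le> 0" and path: "rtrancl_path (bstep bad) z xs w"
    using assms unfolding rch_def rtranclp_eq_rtrancl_path by blast
  obtain ys where ys: "rtrancl_path (bstep bad) z ys w" "distinct (z # ys)"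
    using rtrancl_path_distinct[OF path] by blast
  have "z # ys \<in> walks nbrs (length ys) z" "last (z # ys) = w"
    using walks_of_rtrancl_path[OF ys(1), of nbrs] by (auto simp: bstep_def)
  with height_walks_nbrs[of "z # ys" "length ys" z] \<open>snd w \<le> 0\<close>
  show ?thesis
    by (intro that[of "z # ys" "length ys"] ys(2) downs_bad[OF ys(1)]) auto
qed

section \<open>Edges and the product measure\<close>

lemma lattice_edgeI:
  assumes "even (a + b)" "\<bar>a' - a\<bar> = 1" "\<bar>b' - b\<bar> = 1"
  shows "{(a, b), (a', b')} \<in> lattice_edges"
proof -
  have "(real_of_int a - real_of_int a')\<^sup>2 = (real_of_int \<bar>a' - a\<bar>)\<^sup>2"
    "(real_of_int b - real_of_int b')\<^sup>2 = (real_of_int \<bar>b' - b\<bar>)\<^sup>2"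
    by (simp_all add: power2_commute)
  then have "euclid_dist (a, b) (a', b') = sqrt 2"
    using assms(2,3) by (simp add: euclid_dist_def dist_prod_def dist_real_def)
  moreover have "even (a' + b')"
    using assms by presburger
  ultimately show ?thesis
    using assms(1) unfolding lattice_edges_def lattice_points_def by blast
qed

lemma square_edges_subset: "z \<in> square_centers \<Longrightarrow> square_edges z \<subseteq> lattice_edges"
  by (cases z) (auto simp: square_centers_def intro!: lattice_edgeI)

lemma finite_square_edges [simp]: "finite (square_edges z)"
  by (cases z) simp

lemma card_square_edges_le: "card (square_edges z) \<le> 4"
  by (cases z) (simp add: card_insert_if)

text \<open>A common edge forces the centres into equal or adjacent columns; equal parity leaves one
  column, where different squares have no common edge.\<close>

lemma square_edges_Int:
  assumes "e \<in> square_edges z" "e \<in> square_edges w" "even (fst z) = even (fst w)"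
  shows "z = w"
proof -
  obtain a b a' b' where [simp]: "z = (a, b)" "w = (a', b')"
    by (cases z, cases w)
  have "a = a' \<and> b = b'"
    using assms by (auto simp: doubleton_eq_iff)
  then show ?thesis by simp
qed

text \<open>An injective choice of one edge per square: distinct squares then impose conditions on
  distinct, hence independent, edges.\<close>

definition nw_edge :: "point \<Rightarrow> point set" where
  "nw_edge z = {(fst z, snd z + 1), (fst z - 1, snd z)}"

lemma nw_edge_in_square_edges: "nw_edge z \<in> square_edges z"
  by (cases z) (simp add: nw_edge_def)

lemma inj_nw_edge: "inj nw_edge"
proof (rule injI)
  fix z w :: point
  assume "nw_edge z = nw_edge w"
  then have "fst z = fst w \<and> snd z = snd w"
    by (auto simp: nw_edge_def doubleton_eq_iff)
  then show "z = w" by (simp add: prod_eq_iff)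
qed

lemma countable_lattice_edges: "countable lattice_edges"
proof (rule countable_subset)
  show "lattice_edges \<subseteq> (\<lambda>(u, v). {u, v}) ` UNIV"
    by (auto simp: lattice_edges_def)
qed simp

text \<open>Used to enumerate the edges bijectively by the naturals in the zero-one law; the
  witnesses lie along an antidiagonal.\<close>

lemma infinite_lattice_edges: "infinite lattice_edges"
proof
  have inj: "inj (\<lambda>i::int. nw_edge (i, 1 - i))"
    by (rule injI) (auto dest: injD[OF inj_nw_edge])
  have "nw_edge (i, 1 - i) \<in> lattice_edges" for i
    by (rule subsetD[OF square_edges_subset nw_edge_in_square_edges]) (simp add: square_centers_def)
  then have "range (\<lambda>i. nw_edge (i, 1 - i)) \<subseteq> lattice_edges"
    by auto
  moreover assume "finite lattice_edges"
  ultimately have "finite (range (\<lambda>i. nw_edge (i, 1 - i)))"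
    by (rule finite_subset)
  with inj show False
    using finite_imageD infinite_UNIV_int by blast
qed

abbreviation edge_law :: "real \<Rightarrow> nat measure" where
  "edge_law p \<equiv> measure_pmf (map_pmf of_bool (bernoulli_pmf p))"

lemma prob_space_cost_law: "prob_space (cost_law p)"
  unfolding cost_law_def by (intro prob_space_PiM prob_space_measure_pmf)

lemma space_cost_law: "space (cost_law p) = lattice_edges \<rightarrow>\<^sub>E UNIV"
  by (simp add: cost_law_def space_PiM)

lemma sets_cost_law: "sets (cost_law p) = sets (\<Pi>\<^sub>M e\<in>lattice_edges. count_space UNIV)"
  unfolding cost_law_def by (intro sets_PiM_cong) auto

lemma measurable_cost_law_component:
  "e \<in> lattice_edges \<Longrightarrow> (\<lambda>c. c e) \<in> measurable (cost_law p) (count_space UNIV)"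
  unfolding measurable_cong_sets[OF sets_cost_law refl]
  by (rule measurable_component_singleton)

lemma prob_cylinder:
  assumes J: "finite J" "J \<subseteq> lattice_edges"
  shows "{c \<in> space (cost_law p). \<forall>e\<in>J. c e \<in> B} \<in> sets (cost_law p)" (is ?S)
    and "\<P>(c in cost_law p. \<forall>e\<in>J. c e \<in> B) = measure (edge_law p) B ^ card J" (is ?P)
proof -
  have eq: "{c \<in> space (cost_law p). \<forall>e\<in>J. c e \<in> B} =
      prod_emb lattice_edges (\<lambda>_. edge_law p) J (Pi\<^sub>E J (\<lambda>_. B))"
    using J(2) by (auto simp: prod_emb_def cost_law_def space_PiM PiE_iff extensional_def)
  show ?S
    unfolding eq unfolding cost_law_def using J by (intro sets_PiM_I) auto
  interpret product_prob_space "\<lambda>_. edge_law p" lattice_edges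
    by unfold_locales
  show ?P
    unfolding eq unfolding cost_law_def using J by (subst measure_PiM_emb) auto
qed

lemma measure_edge_law:
  assumes "p \<in> {0..1}"
  shows "measure (edge_law p) {0} = 1 - p" "measure (edge_law p) (- {0}) = p"
proof -
  have 0: "(of_bool -` {0 :: nat} :: bool set) = {False}"
    and 1: "(of_bool -` (- {0 :: nat}) :: bool set) = {True}"
    by (auto simp: of_bool_def split: if_splits)
  show "measure (edge_law p) {0} = 1 - p" "measure (edge_law p) (- {0}) = p"
    using assms unfolding measure_map_pmf 0 1 by (simp_all add: measure_pmf_single)
qed

text \<open>Both measures agree on cylinder sets, whose preimages factor coordinatewise. This serves
  the coupling of two parameters.\<close>

lemma distr_PiM_componentwise:
  assumes M: "\<And>i. i \<in> I \<Longrightarrow> prob_space (M i)"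
    and f: "\<And>i. i \<in> I \<Longrightarrow> f i \<in> measurable (M i) (N i)"
  shows "distr (PiM I M) (PiM I N) (\<lambda>\<omega>. \<lambda>i\<in>I. f i (\<omega> i)) = PiM I (\<lambda>i. distr (M i) (N i) (f i))"
proof (rule measure_eqI_PiM_infinite[symmetric, OF refl])
  have prob: "prob_space (distr (M i) (N i) (f i))" if "i \<in> I" for i
    using M f that by (intro prob_space.prob_space_distr) auto
  then interpret prob_space "PiM I (\<lambda>i. distr (M i) (N i) (f i))"
    by (rule prob_space_PiM)
  show "finite_measure (PiM I (\<lambda>i. distr (M i) (N i) (f i)))"
    by unfold_locales
  have meas: "(\<lambda>\<omega>. \<lambda>i\<in>I. f i (\<omega> i)) \<in> measurable (PiM I M) (PiM I N)"
    using f by (intro measurable_restrict) (auto intro!: measurable_compose[OF measurable_component_singleton])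
  show "sets (distr (PiM I M) (PiM I N) (\<lambda>\<omega>. \<lambda>i\<in>I. f i (\<omega> i))) = sets (PiM I (\<lambda>i. distr (M i) (N i) (f i)))"
    by (auto intro!: sets_PiM_cong)
  fix A J assume J: "finite J" "J \<subseteq> I" and A: "\<And>i. i \<in> J \<Longrightarrow> A i \<in> sets (distr (M i) (N i) (f i))"
  have "prod_emb I (\<lambda>i. distr (M i) (N i) (f i)) J (Pi\<^sub>E J A) = prod_emb I N J (Pi\<^sub>E J A)"
    by (simp add: prod_emb_def)
  moreover have "prod_emb I N J (Pi\<^sub>E J A) \<in> sets (PiM I N)"
    using A J by (intro sets_PiM_I) auto
  moreover have "(\<lambda>\<omega>. \<lambda>i\<in>I. f i (\<omega> i)) -` prod_emb I N J (Pi\<^sub>E J A) \<inter> space (PiM I M)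
      = prod_emb I M J (\<Pi>\<^sub>E i\<in>J. f i -` A i \<inter> space (M i))"
  proof -
    have "f i x \<in> space (N i)" if "i \<in> I" "x \<in> space (M i)" for i x
      using f that by (auto dest: measurable_space)
    with J show ?thesis
      by (fastforce simp: prod_emb_def space_PiM PiE_iff)
  qed
  ultimately show "emeasure (PiM I (\<lambda>i. distr (M i) (N i) (f i))) (prod_emb I (\<lambda>i. distr (M i) (N i) (f i)) J (Pi\<^sub>E J A)) =
      emeasure (distr (PiM I M) (PiM I N) (\<lambda>\<omega>. \<lambda>i\<in>I. f i (\<omega> i))) (prod_emb I (\<lambda>i. distr (M i) (N i) (f i)) J (Pi\<^sub>E J A))"
    using J A f M prob
    by (subst emeasure_PiM_emb) (auto simp: emeasure_distr meas emeasure_PiM_emb subset_eq intro!: prod.cong measurable_sets)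
qed

section \<open>Measurability\<close>

text \<open>\<open>M\<close> is arbitrary because besides \<open>cost_law\<close> also
  sigma-algebras generated by all but finitely many edges occur.\<close>

lemma pred_zero_square:
  assumes "z \<in> square_centers \<Longrightarrow> \<forall>e\<in>square_edges z. (\<lambda>c. c e) \<in> measurable M (count_space UNIV)"
  shows "Measurable.pred M (\<lambda>c. zero_square c z)"
proof (cases "z \<in> square_centers")
  case True
  have "Measurable.pred M (\<lambda>c. c e = 0)" if "e \<in> square_edges z" for e
    using assms True that by (intro pred_eq_const1) auto
  then show ?thesis
    using True unfolding zero_square_def by (intro pred_intros_logic pred_intros_finite) auto
qed (simp add: zero_square_def)

text \<open>By the cone bound only squares with \<open>|x| + y >= b\<close> are inspected, so only
  these are assumed measurable; the zero-one law relies on this.\<close>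

lemma pred_ex_zero_path:
  assumes "\<And>z. b - \<bar>fst z\<bar> \<le> snd z \<Longrightarrow> Measurable.pred M (\<lambda>c. zero_square c z)"
  shows "Measurable.pred M (\<lambda>c. \<exists>y. zero_path c y \<and> y 0 = b)"
proof -
  have "Measurable.pred M (\<lambda>c. zero_square c w)"
    if "d \<in> {1, -1}" "xs \<in> walks (nxt d) n (0, b)" "w \<in> set xs" for d n xs w
    using walks_nxt_cone[OF that(2,3,1)] that(1) by (intro assms) auto
  then show ?thesis
    unfolding ex_zero_path_iff_walks
    by (intro pred_intros_finite pred_intros_countable) (auto intro: finite_walks)
qed

lemma pred_zero_square_cost_law: "Measurable.pred (cost_law p) (\<lambda>c. zero_square c z)"
  by (rule pred_zero_square) (use square_edges_subset measurable_cost_law_component in blast)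

lemma pred_ex_zero_path_cost_law:
  "Measurable.pred (cost_law p) (\<lambda>c. \<exists>y. zero_path c y \<and> y 0 = b)"
  "Measurable.pred (cost_law p) (\<lambda>c. \<exists>y. zero_path c y)"
proof -
  show *: "Measurable.pred (cost_law p) (\<lambda>c. \<exists>y. zero_path c y \<and> y 0 = b)" for b
    by (intro pred_ex_zero_path pred_zero_square_cost_law)
  have "Measurable.pred (cost_law p) (\<lambda>c. \<exists>b. \<exists>y. zero_path c y \<and> y 0 = b)"
    by (intro pred_intros_countable *)
  then show "Measurable.pred (cost_law p) (\<lambda>c. \<exists>y. zero_path c y)"
    by simp
qed

section \<open>A bound for the absence of 0-paths\<close>

text \<open>Only walks to the right are counted, and of each square only its \<open>nw_edge\<close>
  is used, so every square contributes an independent factor \<open>1 - p\<close>.\<close>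

lemma no_zero_path_if_gt_half:
  assumes p: "p \<in> {0..1}" and half: "p > 1 / 2"
  shows "\<P>(c in cost_law p. \<exists>y. zero_path c y) = 0"
proof -
  interpret prob_space "cost_law p" by (rule prob_space_cost_law)
  have bound: "\<P>(c in cost_law p. \<exists>y. zero_path c y \<and> y 0 = b) \<le> (2 * (1 - p)) ^ n"
    if "odd b" for b n
  proof -
    let ?W = "walks (nxt 1) n (0, b)"
    \<comment> \<open>Intersecting with \<open>square_centers\<close> makes \<open>F xs\<close> a
      cylinder event for every list.\<close>
    define F where "F xs = {c \<in> space (cost_law p). \<forall>e\<in>nw_edge ` (set xs \<inter> square_centers). c e \<in> {0}}" for xs
    have sub: "nw_edge ` (set xs \<inter> square_centers) \<subseteq> lattice_edges" for xs
      using square_edges_subset nw_edge_in_square_edges by blast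
    have measF: "F xs \<in> events" for xs
      unfolding F_def by (intro prob_cylinder(1) sub) simp
    have centers: "set xs \<subseteq> square_centers" if "xs \<in> walks (nxt 1) m z" "z \<in> square_centers" for xs m z
      using that
    proof (induction m arbitrary: z xs)
      case (Suc m)
      then obtain u ys where u: "u \<in> nxt 1 z" "ys \<in> walks (nxt 1) m u" and xs: "xs = z # ys"
        by auto
      then have "u \<in> square_centers"
        using Suc.prems(2) by (auto simp: nxt_def square_centers_def)
      with Suc.IH[OF u(2)] Suc.prems(2) xs show ?case by auto
    qed auto
    have probF: "prob (F xs) \<le> (1 - p) ^ n" if xs: "xs \<in> ?W" for xs
    proof -
      have "card (nw_edge ` (set xs \<inter> square_centers)) = Suc n"
        using centers[OF xs] distinct_walks_nxt[OF xs] length_walks[OF xs] \<open>odd b\<close>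
        by (simp add: card_image inj_nw_edge[THEN inj_on_subset] Int_absorb2 square_centers_def distinct_card)
      moreover have "prob (F xs) = measure (edge_law p) {0} ^ card (nw_edge ` (set xs \<inter> square_centers))"
        unfolding F_def by (intro prob_cylinder(2) sub) simp
      ultimately have "prob (F xs) = (1 - p) ^ Suc n"
        by (simp only: measure_edge_law[OF p])
      also have "\<dots> \<le> (1 - p) ^ n"
        using p by (intro power_decreasing) auto
      finally show ?thesis .
    qed
    have "{c \<in> space (cost_law p). \<exists>y. zero_path c y \<and> y 0 = b} \<subseteq> (\<Union>xs\<in>?W. F xs)"
    proof
      fix c assume c: "c \<in> {c \<in> space (cost_law p). \<exists>y. zero_path c y \<and> y 0 = b}"
      then obtain xs where "xs \<in> ?W" and xs: "\<forall>w\<in>set xs. zero_square c w"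
        unfolding ex_zero_path_iff_walks by blast
      have "c (nw_edge w) = 0" if "w \<in> set xs" for w
        using xs that nw_edge_in_square_edges unfolding zero_square_def by blast
      with c \<open>xs \<in> ?W\<close> show "c \<in> (\<Union>xs\<in>?W. F xs)"
        by (intro UN_I) (auto simp: F_def)
    qed
    then have "\<P>(c in cost_law p. \<exists>y. zero_path c y \<and> y 0 = b) \<le> prob (\<Union>xs\<in>?W. F xs)"
    proof (rule finite_measure_mono)
      show "(\<Union>xs\<in>?W. F xs) \<in> events"
        using measF by (intro sets.finite_UN finite_walks) auto
    qed
    also have "\<dots> \<le> (\<Sum>xs\<in>?W. prob (F xs))"
    proof (rule finite_measure_subadditive_finite)
      show "finite ?W"
        by (rule finite_walks) simp
      show "F ` ?W \<subseteq> events"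
        using measF by blast
    qed
    also have "\<dots> \<le> (\<Sum>xs\<in>?W. (1 - p) ^ n)"
      by (intro sum_mono probF)
    also have "\<dots> \<le> 2 ^ n * (1 - p) ^ n"
    proof -
      have "card ?W \<le> 2 ^ n"
        by (rule card_walks_le) (simp_all add: card_nxt_le)
      then have "real (card ?W) \<le> 2 ^ n"
        by (metis of_nat_le_iff of_nat_numeral of_nat_power)
      then show ?thesis
        using p by (simp add: mult_right_mono)
    qed
    finally show ?thesis
      by (simp only: power_mult_distrib)
  qed
  have "AE c in cost_law p. \<not> (\<exists>y. zero_path c y \<and> y 0 = b)" for b
  proof (cases "odd b")
    case True
    have "(\<lambda>n. (2 * (1 - p)) ^ n) \<longlonglongrightarrow> 0"
      using p half by (intro LIMSEQ_power_zero) auto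
    then have "\<P>(c in cost_law p. \<exists>y. zero_path c y \<and> y 0 = b) \<le> 0"
      by (rule LIMSEQ_le_const) (use bound[OF True] in auto)
    then show ?thesis
      using pred_ex_zero_path_cost_law(1)[of b p]
      by (subst AE_iff_measurable[OF _ refl]) (auto simp: emeasure_eq_measure measure_le_0_iff)
  next
    \<comment> \<open>An even height in column 0 is not a centre, so no path passes there.\<close>
    case False
    then show ?thesis
      by (auto simp: zero_path_def zero_square_def square_centers_def)
  qed
  then have "AE c in cost_law p. \<forall>b. \<not> (\<exists>y. zero_path c y \<and> y 0 = b)"
    by (simp add: AE_all_countable)
  then have "AE c in cost_law p. \<not> (\<exists>y. zero_path c y)"
    by eventually_elim blast
  then show ?thesis
    using pred_ex_zero_path_cost_law(2)[of p] by (subst prob_eq_0) auto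
qed

section \<open>Positive probability of 0-paths for small parameters\<close>

text \<open>Each bad square has an edge of nonzero cost; one is chosen per square, in at most
  \<open>4 ^ card W\<close> ways. An edge serves at most two squares, one for each column parity, so
  at least \<open>card W / 2\<close> distinct edges have nonzero cost. The parameter
  \<open>t\<^sup>2\<close> turns this half power into \<open>t ^ card W\<close>.\<close>

lemma prob_all_bad_le:
  assumes W: "finite W" "W \<subseteq> square_centers" and t: "t \<in> {0..1}"
  shows "{c \<in> space (cost_law (t\<^sup>2)). \<forall>z\<in>W. \<not> zero_square c z} \<in> sets (cost_law (t\<^sup>2))"
    and "\<P>(c in cost_law (t\<^sup>2). \<forall>z\<in>W. \<not> zero_square c z) \<le> (4 * t) ^ card W"
proof -
  let ?M = "cost_law (t\<^sup>2)"
  interpret prob_space ?M by (rule prob_space_cost_law)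
  have "Measurable.pred ?M (\<lambda>c. \<forall>z\<in>W. \<not> zero_square c z)"
    by (intro pred_intros_finite pred_intros_logic pred_zero_square_cost_law W)
  then show meas: "{c \<in> space ?M. \<forall>z\<in>W. \<not> zero_square c z} \<in> sets ?M"
    by simp
  let ?F = "Pi\<^sub>E W square_edges"
  define G where "G f = {c \<in> space ?M. \<forall>e\<in>f ` W. c e \<in> - {0}}" for f :: "point \<Rightarrow> point set"
  have sub: "f ` W \<subseteq> lattice_edges" if "f \<in> ?F" for f
  proof (rule image_subsetI)
    fix z assume "z \<in> W"
    with that W(2) have "f z \<in> square_edges z" "z \<in> square_centers"
      by (auto simp only: PiE_iff)
    then show "f z \<in> lattice_edges"
      using square_edges_subset by blast
  qed
  have measG: "G f \<in> sets ?M" if "f \<in> ?F" for f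
    unfolding G_def using W sub[OF that] by (intro prob_cylinder(1)) auto
  have fin: "finite ?F"
    using W by (intro finite_PiE) auto
  have t2: "t\<^sup>2 \<in> {0..1}"
    using t by (auto simp: power_le_one)
  have probG: "prob (G f) \<le> t ^ card W" if f: "f \<in> ?F" for f
  proof -
    \<comment> \<open>\<open>P\<close> selects one column parity: the condition says that at most
      one truth value satisfies it.\<close>
    have inj: "inj_on f {z \<in> W. P (even (fst z))}" if "\<And>b b'. P b \<Longrightarrow> P b' \<Longrightarrow> b = b'" for P
    proof (rule inj_onI)
      fix z w assume "z \<in> {z \<in> W. P (even (fst z))}" "w \<in> {z \<in> W. P (even (fst z))}" and eq: "f z = f w"
      then have "f z \<in> square_edges z" "f w \<in> square_edges w" "even (fst z) = even (fst w)"
        using f that by (auto simp only: PiE_iff mem_Collect_eq)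
      with eq show "z = w"
        using square_edges_Int by metis
    qed
    have le: "card {z \<in> W. P (even (fst z))} \<le> card (f ` W)" if "\<And>b b'. P b \<Longrightarrow> P b' \<Longrightarrow> b = b'" for P
      using W by (intro card_inj_on_le[OF inj[OF that]]) auto
    have "card W = card {z \<in> W. even (fst z)} + card {z \<in> W. odd (fst z)}"
      using W(1) by (subst card_Un_disjoint[symmetric]) (auto intro!: arg_cong[where f = card])
    also have "\<dots> \<le> 2 * card (f ` W)"
      using le[of "\<lambda>b. b"] le[of "\<lambda>b. \<not> b"] by simp
    finally have "card W \<le> 2 * card (f ` W)" .
    moreover have "prob (G f) = measure (edge_law (t\<^sup>2)) (- {0}) ^ card (f ` W)"
      unfolding G_def using W sub[OF f] by (intro prob_cylinder(2)) auto
    then have "prob (G f) = t ^ (2 * card (f ` W))"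
      by (simp only: measure_edge_law[OF t2] power_mult)
    ultimately show ?thesis
      using t by (simp add: power_decreasing)
  qed
  have "{c \<in> space ?M. \<forall>z\<in>W. \<not> zero_square c z} \<subseteq> (\<Union>f\<in>?F. G f)"
  proof
    fix c assume c: "c \<in> {c \<in> space ?M. \<forall>z\<in>W. \<not> zero_square c z}"
    then have "\<forall>z\<in>W. \<exists>e\<in>square_edges z. c e \<noteq> 0"
      using W(2) by (auto simp: zero_square_def)
    then obtain f where "\<forall>z\<in>W. f z \<in> square_edges z \<and> c (f z) \<noteq> 0"
      by metis
    with c show "c \<in> (\<Union>f\<in>?F. G f)"
      by (intro UN_I[of "restrict f W"]) (auto simp: G_def)
  qed
  then have "\<P>(c in ?M. \<forall>z\<in>W. \<not> zero_square c z) \<le> prob (\<Union>f\<in>?F. G f)"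
    by (intro finite_measure_mono sets.finite_UN fin measG)
  also have "\<dots> \<le> (\<Sum>f\<in>?F. prob (G f))"
    using measG by (intro finite_measure_subadditive_finite fin) auto
  also have "\<dots> \<le> real (card ?F) * t ^ card W"
    by (rule sum_bounded_above) (rule probG)
  also have "card ?F = (\<Prod>z\<in>W. card (square_edges z))"
    using W by (intro card_PiE)
  also have "real \<dots> \<le> (\<Prod>z\<in>W. 4)"
    unfolding of_nat_prod using card_square_edges_le
    by (intro prod_mono conjI of_nat_0_le_iff) (simp only: of_nat_le_iff of_nat_numeral[symmetric, where 'a=real])
  finally show "\<P>(c in ?M. \<forall>z\<in>W. \<not> zero_square c z) \<le> (4 * t) ^ card W"
    using t by (simp add: power_mult_distrib mult_right_mono)
qed

text \<open>The value \<open>1/864\<close> is chosen so that \<open>4 / 864 = (1/6)^3\<close>: a walk with \<open>n\<close> steps that is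
  counted below uses more than \<open>n / 3\<close> bad squares, and there are at most \<open>3 ^ n\<close> such walks.\<close>

lemma zero_path_pos_small: "\<P>(c in cost_law ((1 / 864)\<^sup>2). \<exists>y. zero_path c y) > 0"
proof -
  let ?M = "cost_law ((1 / 864)\<^sup>2)"
  interpret prob_space ?M by (rule prob_space_cost_law)
  define X where "X n = {xs \<in> walks nbrs n (0, 1). distinct xs \<and> 1 + int n \<le> 3 * int (length (downs xs))}" for n
  define B where "B xs = {c \<in> space ?M. \<forall>z\<in>set (downs xs). \<not> zero_square c z}" for xs
  have fin_nbrs: "finite (nbrs z)" and card_nbrs: "card (nbrs z) \<le> 3" for z
    by (simp_all add: nbrs_def card_insert_if)
  have finX: "finite (X n)" for n
    unfolding X_def using finite_walks[of nbrs, OF fin_nbrs] by simp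
  have sub: "set (downs xs) \<subseteq> square_centers" if "xs \<in> X n" for xs n
    using that walks_nbrs_centers[of xs n "(0, 1)"] set_downs_subset[of xs]
    by (auto simp: X_def square_centers_def)
  have measB: "B xs \<in> sets ?M" if "xs \<in> X n" for xs n
    unfolding B_def using sub[OF that] by (intro prob_all_bad_le(1)) auto
  have probB: "prob (B xs) \<le> (1 / 6) ^ (n + 1)" if xs: "xs \<in> X n" for xs n
  proof -
    have "prob (B xs) \<le> (4 * (1 / 864)) ^ card (set (downs xs))"
      unfolding B_def using sub[OF xs] by (intro prob_all_bad_le(2)) auto
    also have "card (set (downs xs)) = length (downs xs)"
      using xs by (intro distinct_card distinct_downs) (auto simp: X_def)
    also have "(4 * (1 / 864) :: real) ^ length (downs xs) = (1 / 6) ^ (3 * length (downs xs))"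
      by (subst power_mult) (simp add: power3_eq_cube)
    also have "\<dots> \<le> (1 / 6) ^ (n + 1)"
      using xs by (intro power_decreasing) (auto simp: X_def)
    finally show ?thesis .
  qed
  define C where "C n = (\<Union>xs\<in>X n. B xs)" for n
  have measC: "C n \<in> sets ?M" for n
    unfolding C_def using measB finX by (intro sets.finite_UN) auto
  have probC: "prob (C n) \<le> (1 / 6) * (1 / 2) ^ n" for n
  proof -
    have "prob (C n) \<le> (\<Sum>xs\<in>X n. prob (B xs))"
      unfolding C_def using measB finX by (intro finite_measure_subadditive_finite) auto
    also have "\<dots> \<le> real (card (X n)) * (1 / 6) ^ (n + 1)"
      by (rule sum_bounded_above) (rule probB)
    also have "\<dots> \<le> 3 ^ n * (1 / 6) ^ (n + 1)"
    proof (intro mult_right_mono)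
      have "card (X n) \<le> card (walks nbrs n (0, 1))"
        unfolding X_def by (intro card_mono finite_walks fin_nbrs) auto
      also have "\<dots> \<le> 3 ^ n"
        by (intro card_walks_le fin_nbrs card_nbrs)
      finally show "real (card (X n)) \<le> 3 ^ n"
        by (metis of_nat_le_iff of_nat_numeral of_nat_power)
    qed simp
    also have "\<dots> = (1 / 6) * (3 * (1 / 6)) ^ n"
      unfolding power_mult_distrib by simp
    finally show ?thesis by simp
  qed
  \<comment> \<open>The union bound sums to 1/3, so a 0-path exists with probability at least
    2/3.\<close>
  have sum: "(\<lambda>n. (1 / 6) * (1 / 2 :: real) ^ n) sums ((1 / 6) * (1 / (1 - 1 / 2)))"
    by (intro sums_mult geometric_sums) simp
  have summable: "summable (\<lambda>n. prob (C n))"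
    using probC by (intro summable_comparison_test'[OF sums_summable[OF sum]]) auto
  have "prob (\<Union>n. C n) \<le> (\<Sum>n. prob (C n))"
    using measC by (intro finite_measure_subadditive_countably summable) auto
  also have "\<dots> \<le> (\<Sum>n. (1 / 6) * (1 / 2) ^ n)"
    by (intro suminf_le probC summable sums_summable[OF sum])
  also have "\<dots> = 1 / 3"
    using sums_unique[OF sum] by simp
  finally have C: "prob (\<Union>n. C n) \<le> 1 / 3" .
  have "space ?M - (\<Union>n. C n) \<subseteq> {c \<in> space ?M. \<exists>y. zero_path c y}"
  proof
    fix c assume c: "c \<in> space ?M - (\<Union>n. C n)"
    have "\<not> rch (\<lambda>z. \<not> zero_square c z) (0, 1)"
    proof
      assume "rch (\<lambda>z. \<not> zero_square c z) (0, 1)"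
      then obtain n xs where "xs \<in> X n" "c \<in> B xs"
        by (rule rch_imp_bad_walk) (use c in \<open>auto simp: X_def B_def\<close>)
      with c show False by (auto simp: C_def)
    qed
    with c show "c \<in> {c \<in> space ?M. \<exists>y. zero_path c y}"
      using zero_path_if_not_rch by auto
  qed
  then have "prob (space ?M - (\<Union>n. C n)) \<le> \<P>(c in ?M. \<exists>y. zero_path c y)"
    using pred_ex_zero_path_cost_law(2) by (intro finite_measure_mono) auto
  with C measC show ?thesis
    by (subst (asm) prob_compl) auto
qed

section \<open>Monotonicity and translation invariance\<close>

lemma zero_path_antimono:
  assumes "zero_path c y" "\<And>e. e \<in> lattice_edges \<Longrightarrow> c' e \<le> c e"
  shows "zero_path c' y"
proof -
  have "zero_square c' z" if "zero_square c z" for z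
    unfolding zero_square_def
  proof (intro conjI ballI)
    show z: "z \<in> square_centers"
      using that by (simp add: zero_square_def)
    fix e assume e: "e \<in> square_edges z"
    have "c' e \<le> c e"
      using square_edges_subset[OF z] e by (intro assms(2)) blast
    then show "c' e = 0"
      using that e by (simp add: zero_square_def)
  qed
  with assms(1) show ?thesis unfolding zero_path_def by blast
qed

text \<open>Multiplying a Bernoulli(\<open>q\<close>) cost by an independent
  Bernoulli(\<open>p / q\<close>) factor gives a Bernoulli(\<open>p\<close>) cost that is nowhere
  larger, so 0-paths survive.\<close>

lemma prob_zero_path_antimono:
  assumes "p \<in> {0..1}" "q \<in> {0..1}" "p \<le> q"
  shows "\<P>(c in cost_law q. \<exists>y. zero_path c y) \<le> \<P>(c in cost_law p. \<exists>y. zero_path c y)"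
proof (cases "q = 0")
  case False
  define r where "r = p / q"
  have r: "r \<in> {0..1}" and p: "p = q * r"
    using assms False by (auto simp: r_def)
  let ?Q = "pair_pmf (bernoulli_pmf q) (bernoulli_pmf r)"
  let ?N = "\<Pi>\<^sub>M e\<in>lattice_edges. measure_pmf ?Q"
  let ?L = "\<lambda>f \<omega>. \<lambda>e\<in>lattice_edges. f (\<omega> e) :: nat"
  interpret N: prob_space ?N
    by (intro prob_space_PiM prob_space_measure_pmf)
  have law: "distr ?N (\<Pi>\<^sub>M e\<in>lattice_edges. count_space UNIV) (?L f) = cost_law s"
    if "map_pmf f ?Q = map_pmf of_bool (bernoulli_pmf s)" for f s
    unfolding cost_law_def that[symmetric] map_pmf_rep_eq
    by (rule distr_PiM_componentwise[where f = "\<lambda>_. f" and M = "\<lambda>_. measure_pmf ?Q" and N = "\<lambda>_. count_space UNIV"])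
      (auto intro: prob_space_measure_pmf)
  have meas: "?L f \<in> measurable ?N (\<Pi>\<^sub>M e\<in>lattice_edges. count_space UNIV)" for f
    by (intro measurable_restrict measurable_compose[OF measurable_component_singleton]) auto
  have 1: "map_pmf (\<lambda>x. of_bool (fst x) :: nat) ?Q = map_pmf of_bool (bernoulli_pmf q)"
    using arg_cong[OF map_fst_pair_pmf[of "bernoulli_pmf q" "bernoulli_pmf r"], of "map_pmf of_bool"]
    by (simp only: pmf.map_comp o_def)
  have and_law: "map_pmf (\<lambda>x. fst x \<and> snd x) ?Q = bernoulli_pmf p"
  proof (rule pmf_eqI)
    fix b :: bool
    have T: "pmf (map_pmf (\<lambda>x. fst x \<and> snd x) ?Q) True = pmf (bernoulli_pmf p) True"
    proof -
      have "((\<lambda>x. fst x \<and> snd x) -` {True}) = {(True, True)}"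
        by (intro set_eqI) (simp add: prod_eq_iff)
      then have "pmf (map_pmf (\<lambda>x. fst x \<and> snd x) ?Q) True = pmf ?Q (True, True)"
        by (simp only: pmf_map measure_pmf_single)
      also have "\<dots> = q * r"
        using assms(2) r by (simp add: pmf_pair)
      also have "\<dots> = p"
        by (rule p[symmetric])
      also have "p = pmf (bernoulli_pmf p) True"
        using assms(1) by simp
      finally show ?thesis .
    qed
    then show "pmf (map_pmf (\<lambda>x. fst x \<and> snd x) ?Q) b = pmf (bernoulli_pmf p) b"
      by (cases b) (auto simp: pmf_False_conv_True)
  qed
  have 2: "map_pmf (\<lambda>x. of_bool (fst x \<and> snd x) :: nat) ?Q = map_pmf of_bool (bernoulli_pmf p)"
    unfolding and_law[symmetric] by (simp only: pmf.map_comp o_def)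
  \<comment> \<open>Moves the event to the space of pairs, where both cost fields are functions of
    the same sample.\<close>
  have prob: "\<P>(c in cost_law s. \<exists>y. zero_path c y) = \<P>(\<omega> in ?N. \<exists>y. zero_path (?L f \<omega>) y)"
    and events: "{\<omega> \<in> space ?N. \<exists>y. zero_path (?L f \<omega>) y} \<in> sets ?N"
    if "map_pmf f ?Q = map_pmf of_bool (bernoulli_pmf s)" for f s
  proof -
    let ?P = "\<Pi>\<^sub>M e\<in>lattice_edges. count_space (UNIV :: nat set)"
    have S: "{c \<in> space (cost_law s). \<exists>y. zero_path c y} \<in> sets ?P"
      using pred_ex_zero_path_cost_law(2)[of s] by (simp add: sets_cost_law pred_def)
    have eq: "?L f -` {c \<in> space (cost_law s). \<exists>y. zero_path c y} \<inter> space ?N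
        = {\<omega> \<in> space ?N. \<exists>y. zero_path (?L f \<omega>) y}"
      by (auto simp: space_cost_law)
    show "{\<omega> \<in> space ?N. \<exists>y. zero_path (?L f \<omega>) y} \<in> sets ?N"
      unfolding eq[symmetric] by (rule measurable_sets[OF meas S])
    have "\<P>(c in cost_law s. \<exists>y. zero_path c y)
        = measure (distr ?N ?P (?L f)) {c \<in> space (cost_law s). \<exists>y. zero_path c y}"
      by (simp only: law[OF that])
    then show "\<P>(c in cost_law s. \<exists>y. zero_path c y) = \<P>(\<omega> in ?N. \<exists>y. zero_path (?L f \<omega>) y)"
      by (simp only: measure_distr[OF meas S] eq)
  qed
  show ?thesis
    unfolding prob[OF 1] prob[OF 2]
  proof (rule N.finite_measure_mono[OF _ events[OF 2]])
    show "{\<omega> \<in> space ?N. \<exists>y. zero_path (?L (\<lambda>x. of_bool (fst x)) \<omega>) y}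
        \<subseteq> {\<omega> \<in> space ?N. \<exists>y. zero_path (?L (\<lambda>x. of_bool (fst x \<and> snd x)) \<omega>) y}"
    proof (rule subsetI)
      fix \<omega> assume "\<omega> \<in> {\<omega> \<in> space ?N. \<exists>y. zero_path (?L (\<lambda>x. of_bool (fst x)) \<omega>) y}"
      then obtain y where \<omega>: "\<omega> \<in> space ?N" and y: "zero_path (?L (\<lambda>x. of_bool (fst x)) \<omega>) y"
        by blast
      from y have "zero_path (?L (\<lambda>x. of_bool (fst x \<and> snd x)) \<omega>) y"
        by (rule zero_path_antimono) simp
      with \<omega> show "\<omega> \<in> {\<omega> \<in> space ?N. \<exists>y. zero_path (?L (\<lambda>x. of_bool (fst x \<and> snd x)) \<omega>) y}"
        by blast
    qed
  qed
next
  case True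
  then have "p = q" using assms by auto
  then show ?thesis by simp
qed

section \<open>Vertical translations\<close>

definition shift :: "int \<Rightarrow> (point set \<Rightarrow> nat) \<Rightarrow> point set \<Rightarrow> nat" where
  "shift b c = (\<lambda>e\<in>lattice_edges. c ((\<lambda>w. (fst w, snd w + b)) ` e))"

lemma shift_lattice_edges:
  assumes "even b" "e \<in> lattice_edges"
  shows "(\<lambda>w. (fst w, snd w + b)) ` e \<in> lattice_edges"
proof -
  obtain u v where e: "e = {u, v}" "u \<in> lattice_points" "v \<in> lattice_points" "euclid_dist u v = sqrt 2"
    using assms(2) unfolding lattice_edges_def by blast
  have "euclid_dist (fst u, snd u + b) (fst v, snd v + b) = euclid_dist u v"
    by (simp add: euclid_dist_def dist_prod_def dist_real_def)
  with e assms(1) show ?thesis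
    unfolding lattice_edges_def lattice_points_def
    by (intro CollectI exI[of _ "(fst u, snd u + b)"] exI[of _ "(fst v, snd v + b)"]) auto
qed

lemma distr_shift:
  assumes "even b"
  shows "shift b \<in> measurable (cost_law p) (cost_law p)"
    and "distr (cost_law p) (cost_law p) (shift b) = cost_law p"
proof -
  have inj: "inj_on ((`) (\<lambda>w::point. (fst w, snd w + b))) lattice_edges"
  proof (rule inj_on_image[of _ "lattice_edges", THEN inj_on_subset])
    show "inj_on (\<lambda>w::point. (fst w, snd w + b)) (\<Union> lattice_edges)"
      by (auto simp: inj_on_def prod_eq_iff)
  qed auto
  show "distr (cost_law p) (cost_law p) (shift b) = cost_law p"
    unfolding cost_law_def shift_def using assms
    by (intro distr_PiM_reindex inj) (auto intro: prob_space_measure_pmf shift_lattice_edges)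
  show "shift b \<in> measurable (cost_law p) (cost_law p)"
    unfolding cost_law_def shift_def using assms
    by (intro measurable_restrict measurable_component_singleton shift_lattice_edges)
qed

lemma zero_square_shift:
  assumes "even b"
  shows "zero_square (shift b c) (x, y) \<longleftrightarrow> zero_square c (x, y + b)"
proof -
  have edges: "square_edges (x, y + b) = (`) (\<lambda>w. (fst w, snd w + b)) ` square_edges (x, y)"
    by (simp add: algebra_simps)
  have "shift b c e = c ((\<lambda>w. (fst w, snd w + b)) ` e)" if "(x, y) \<in> square_centers" "e \<in> square_edges (x, y)" for e
    using square_edges_subset that by (auto simp: shift_def)
  moreover have "(x, y + b) \<in> square_centers \<longleftrightarrow> (x, y) \<in> square_centers"
    using assms by (simp add: square_centers_def)
  ultimately show ?thesis
    unfolding zero_square_def edges by (auto simp del: square_edges.simps)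
qed

text \<open>An even vertical translation preserves the lattice and only reindexes i.i.d. costs, so
  it preserves \<open>cost_law\<close>.\<close>

lemma prob_zero_path_shift:
  assumes "even b"
  shows "\<P>(c in cost_law p. \<exists>y. zero_path c y \<and> y 0 = h + b) = \<P>(c in cost_law p. \<exists>y. zero_path c y \<and> y 0 = h)"
proof -
  let ?A = "{c \<in> space (cost_law p). \<exists>y. zero_path c y \<and> y 0 = h}"
  have eq: "(\<exists>y. zero_path (shift b c) y \<and> y 0 = h) \<longleftrightarrow> (\<exists>y. zero_path c y \<and> y 0 = h + b)" for c
  proof
    assume "\<exists>y. zero_path (shift b c) y \<and> y 0 = h"
    then obtain y where "zero_path (shift b c) y" "y 0 = h" by blast
    then show "\<exists>y. zero_path c y \<and> y 0 = h + b"
      using assms by (intro exI[of _ "\<lambda>i. y i + b"]) (simp add: zero_path_def zero_square_shift)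
  next
    assume "\<exists>y. zero_path c y \<and> y 0 = h + b"
    then obtain y where "zero_path c y" "y 0 = h + b" by blast
    then show "\<exists>y. zero_path (shift b c) y \<and> y 0 = h"
      using assms by (intro exI[of _ "\<lambda>i. y i - b"]) (simp add: zero_path_def zero_square_shift)
  qed
  have "measure (cost_law p) ?A = measure (distr (cost_law p) (cost_law p) (shift b)) ?A"
    by (simp only: distr_shift(2)[OF assms])
  also have "\<dots> = measure (cost_law p) (shift b -` ?A \<inter> space (cost_law p))"
    using pred_ex_zero_path_cost_law(1)[of h p]
    by (intro measure_distr distr_shift(1) assms) (simp add: pred_def)
  also have "shift b -` ?A \<inter> space (cost_law p) = {c \<in> space (cost_law p). \<exists>y. zero_path c y \<and> y 0 = h + b}"
    using measurable_space[OF distr_shift(1)[OF assms]] by (auto simp: eq)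
  finally show ?thesis by simp
qed

section \<open>The zero-one law\<close>

text \<open>The joint law of the enumerated costs is the product of their marginals, by reindexing
  the product measure; this is the independence that Kolmogorov's law takes.\<close>

lemma indep_vars_edges:
  assumes e: "inj e" "range e \<subseteq> lattice_edges"
  shows "prob_space.indep_vars (cost_law p) (\<lambda>_. count_space UNIV) (\<lambda>i c. c (e i)) (UNIV :: nat set)"
proof -
  interpret prob_space "cost_law p" by (rule prob_space_cost_law)
  have meas: "(\<lambda>c. c (e i)) \<in> measurable (cost_law p) (count_space UNIV)" for i
    using e by (intro measurable_cost_law_component) auto
  have "distr (cost_law p) (\<Pi>\<^sub>M i\<in>UNIV. count_space UNIV) (\<lambda>c. \<lambda>i\<in>UNIV. c (e i))
      = distr (cost_law p) (\<Pi>\<^sub>M i\<in>UNIV. edge_law p) (\<lambda>c. \<lambda>i\<in>UNIV. c (e i))"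
    by (intro distr_cong sets_PiM_cong) auto
  also have "\<dots> = (\<Pi>\<^sub>M i\<in>UNIV. edge_law p)"
    unfolding cost_law_def using e
    by (intro distr_PiM_reindex) (auto intro: prob_space_measure_pmf)
  also have "\<dots> = (\<Pi>\<^sub>M i\<in>UNIV. distr (cost_law p) (count_space UNIV) (\<lambda>c. c (e i)))"
  proof (intro PiM_cong refl)
    fix i
    have "distr (cost_law p) (edge_law p) (\<lambda>c. c (e i)) = edge_law p"
      unfolding cost_law_def using e by (intro distr_PiM_component) (auto intro: prob_space_measure_pmf)
    moreover have "distr (cost_law p) (edge_law p) (\<lambda>c. c (e i)) = distr (cost_law p) (count_space UNIV) (\<lambda>c. c (e i))"
      by (intro distr_cong) auto
    ultimately show "edge_law p = distr (cost_law p) (count_space UNIV) (\<lambda>c. c (e i))"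
      by simp
  qed
  finally show ?thesis
    using meas by (subst indep_vars_iff_distr_eq_PiM) auto
qed

text \<open>Bounds the quantity \<open>|x| + y\<close> of the cone estimate, so that a path crossing
  column 0 high enough avoids \<open>F\<close>.\<close>

lemma finite_edges_height_bound:
  assumes "finite F" "F \<subseteq> lattice_edges"
  obtains m where "\<And>e w. e \<in> F \<Longrightarrow> w \<in> e \<Longrightarrow> \<bar>fst w\<bar> + snd w < m"
proof -
  have "finite (\<Union> F)"
    using assms by (auto simp: lattice_edges_def)
  then have "finite ((\<lambda>w. \<bar>fst w\<bar> + snd w) ` \<Union> F)"
    by (rule finite_imageI)
  then obtain m where "\<And>v. v \<in> (\<lambda>w. \<bar>fst w\<bar> + snd w) ` \<Union> F \<Longrightarrow> v \<le> m"
    using bdd_above_finite[of "(\<lambda>w. \<bar>fst w\<bar> + snd w) ` \<Union> F"] unfolding bdd_above_def by blast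
  then have "\<bar>fst w\<bar> + snd w < m + 1" if "e \<in> F" "w \<in> e" for e w
    using that by (auto simp: zless_add1_eq order.order_iff_strict)
  then show ?thesis
    by (rule that)
qed

text \<open>Dropping finitely many \<open>k\<close> does not change the event, and paths through
  high points avoid the first \<open>n\<close> edges; so it is a tail event and Kolmogorov's law
  applies.\<close>

lemma zero_one_zero_paths_io:
  fixes h :: int and p :: real
  defines "L \<equiv> {c \<in> space (cost_law p). \<forall>m. \<exists>k\<ge>m. \<exists>y. zero_path c y \<and> y 0 = h + 2 * int k}"
  shows "measure (cost_law p) L = 0 \<or> measure (cost_law p) L = 1"
proof -
  interpret prob_space "cost_law p" by (rule prob_space_cost_law)
  define e where "e = from_nat_into lattice_edges"
  have "bij_betw e UNIV lattice_edges"
    unfolding e_def by (intro bij_betw_from_nat_into countable_lattice_edges infinite_lattice_edges)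
  then have inj: "inj e" and range: "range e = lattice_edges"
    by (auto simp: bij_betw_def)
  define A where "A i = {(\<lambda>c. c (e i)) -` B \<inter> space (cost_law p) | B. B \<in> sets (count_space UNIV)}" for i
  have indep: "indep_sets A UNIV"
    using indep_vars_edges[OF inj, of p] range unfolding A_def indep_vars_def2 by blast
  have alg: "sigma_algebra (space (cost_law p)) (A i)" for i
  proof -
    have "A i = sets (vimage_algebra (space (cost_law p)) (\<lambda>c. c (e i)) (count_space UNIV))"
      unfolding A_def by (rule sets_vimage_algebra2[symmetric]) simp
    then show ?thesis
      by (metis sets.sigma_algebra_axioms space_vimage_algebra)
  qed
  have "L \<in> sigma_sets (space (cost_law p)) (\<Union> (A ` {n..}))" for n
  proof -
    define N where "N = sigma (space (cost_law p)) (\<Union> (A ` {n..}))"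
    have sub: "\<Union> (A ` {n..}) \<subseteq> Pow (space (cost_law p))"
      by (auto simp: A_def)
    have space_N: "space N = space (cost_law p)" and sets_N: "sets N = sigma_sets (space (cost_law p)) (\<Union> (A ` {n..}))"
      unfolding N_def using sub by (simp_all add: space_measure_of_conv sets_measure_of)
    have meas: "(\<lambda>c. c (e i)) \<in> measurable N (count_space UNIV)" if "n \<le> i" for i
    proof (rule measurableI)
      fix B :: "nat set" assume "B \<in> sets (count_space UNIV)"
      then show "(\<lambda>c. c (e i)) -` B \<inter> space N \<in> sets N"
        using that unfolding sets_N space_N by (intro sigma_sets.Basic) (auto simp: A_def)
    qed simp
    obtain m where m: "\<And>f w. f \<in> e ` {..<n} \<Longrightarrow> w \<in> f \<Longrightarrow> \<bar>fst w\<bar> + snd w < m"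
      by (rule finite_edges_height_bound[of "e ` {..<n}"]) (use range in auto)
    have square: "Measurable.pred N (\<lambda>c. zero_square c z)" if z: "m + 1 \<le> \<bar>fst z\<bar> + snd z" for z
    proof (rule pred_zero_square, rule ballI)
      fix f assume "z \<in> square_centers" and f: "f \<in> square_edges z"
      then obtain i where i: "f = e i"
        using square_edges_subset range by blast
      \<comment> \<open>Every edge of a square contains its top or bottom corner, at most 1 below
        the centre; hence the margin in \<open>m + 1\<close>.\<close>
      have "\<exists>w\<in>f. m \<le> \<bar>fst w\<bar> + snd w"
        using f z by (cases z) auto
      then have "f \<notin> e ` {..<n}"
        using m by fastforce
      then show "(\<lambda>c. c f) \<in> measurable N (count_space UNIV)"
        using meas[of i] i by force
    qed
    have path: "Measurable.pred N (\<lambda>c. \<exists>y. zero_path c y \<and> y 0 = b)" if "m + 1 \<le> b" for b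
      by (intro pred_ex_zero_path square) (use that in linarith)
    \<comment> \<open>Lets the guard on \<open>k\<close> be assumed while the path event is shown
      measurable.\<close>
    have conj: "Measurable.pred N (\<lambda>c. b \<and> P c)" if "b \<Longrightarrow> Measurable.pred N P" for b P
      using that by (cases b) simp_all
    \<comment> \<open>From \<open>k0\<close> on, the height \<open>h + 2 * int k\<close> is at least
      \<open>m + 1\<close>.\<close>
    define k0 where "k0 = nat (m + 1 - h)"
    have pred: "Measurable.pred N (\<lambda>c. \<forall>m. \<exists>k. max m k0 \<le> k \<and> (\<exists>y. zero_path c y \<and> y 0 = h + 2 * int k))"
    proof (intro pred_intros_countable conj)
      fix m' k :: nat
      assume "max m' k0 \<le> k"
      then have "k0 \<le> k"
        by simp
      then show "Measurable.pred N (\<lambda>c. \<exists>y. zero_path c y \<and> y 0 = h + 2 * int k)"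
        unfolding k0_def by (intro path) linarith
    qed
    have iff: "(\<forall>m. \<exists>k. max m k0 \<le> k \<and> P k) \<longleftrightarrow> (\<forall>m. \<exists>k\<ge>m. P k)" for P
    proof
      assume *: "\<forall>m. \<exists>k. max m k0 \<le> k \<and> P k"
      show "\<forall>m. \<exists>k\<ge>m. P k"
      proof
        fix m
        obtain k where "max m k0 \<le> k" "P k"
          using * by blast
        then show "\<exists>k\<ge>m. P k"
          by (intro exI[of _ k]) simp
      qed
    next
      assume "\<forall>m. \<exists>k\<ge>m. P k"
      then show "\<forall>m. \<exists>k. max m k0 \<le> k \<and> P k"
        by (intro allI) blast
    qed
    from pred have "{c \<in> space N. \<forall>m. \<exists>k\<ge>m. \<exists>y. zero_path c y \<and> y 0 = h + 2 * int k} \<in> sets N"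
      unfolding iff by (rule predE)
    then show ?thesis
      unfolding L_def space_N sets_N .
  qed
  then show ?thesis
    by (intro kolmogorov_0_1_law[OF alg indep]) (auto simp: tail_events_def)
qed

text \<open>Some crossing height \<open>h\<close> of column 0 has positive probability, and by
  translation every \<open>h + 2 * int m\<close> has the same one. Continuity from above carries
  this lower bound over to infinitely many crossings, an event of probability 0 or 1.\<close>

lemma AE_zero_path:
  assumes pos: "\<P>(c in cost_law p. \<exists>y. zero_path c y) > 0"
  shows "AE c in cost_law p. \<exists>y. zero_path c y"
proof -
  interpret prob_space "cost_law p" by (rule prob_space_cost_law)
  define Z where "Z b = {c \<in> space (cost_law p). \<exists>y. zero_path c y \<and> y 0 = b}" for b
  have measZ: "Z b \<in> events" for b
    unfolding Z_def using pred_ex_zero_path_cost_law(1) by (simp add: pred_def)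
  have "\<exists>h. prob (Z h) > 0"
  proof (rule ccontr)
    assume "\<not> (\<exists>h. prob (Z h) > 0)"
    then have "AE c in cost_law p. c \<notin> Z h" for h
      using measZ by (intro AE_not_in) (auto simp: null_sets_def emeasure_eq_measure not_less measure_le_0_iff)
    then have "AE c in cost_law p. \<forall>h. c \<notin> Z h"
      by (simp add: AE_all_countable)
    then have "AE c in cost_law p. \<not> (\<exists>y. zero_path c y)"
      using AE_space by eventually_elim (auto simp: Z_def)
    then have "\<P>(c in cost_law p. \<exists>y. zero_path c y) = 0"
      using pred_ex_zero_path_cost_law(2)[of p] by (subst prob_eq_0) (auto simp: pred_def)
    with pos show False by simp
  qed
  then obtain h where h: "prob (Z h) > 0" ..
  define L where "L = {c \<in> space (cost_law p). \<forall>m. \<exists>k\<ge>m. \<exists>y. zero_path c y \<and> y 0 = h + 2 * int k}"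
  define U where "U m = (\<Union>k\<in>{m..}. Z (h + 2 * int k))" for m :: nat
  have measU: "U m \<in> events" for m
    unfolding U_def using measZ by (intro sets.countable_UN') auto
  have L: "L = (\<Inter>m. U m)"
    by (auto simp: L_def U_def Z_def Bex_def)
  have "decseq U"
    unfolding decseq_def U_def by (intro allI impI UN_mono) auto
  then have "(\<lambda>m. prob (U m)) \<longlonglongrightarrow> prob L"
    unfolding L using measU by (intro finite_Lim_measure_decseq) auto
  moreover have "prob (Z h) \<le> prob (U m)" for m
  proof -
    have "prob (Z h) = prob (Z (h + 2 * int m))"
      unfolding Z_def by (rule prob_zero_path_shift[symmetric]) simp
    also have "\<dots> \<le> prob (U m)"
      by (intro finite_measure_mono measU) (auto simp: U_def)
    finally show ?thesis .
  qed
  ultimately have "prob (Z h) \<le> prob L"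
    by (intro LIMSEQ_le_const) auto
  then have "prob L = 1"
    using zero_one_zero_paths_io[of p h] h by (auto simp: L_def)
  then have "AE c in cost_law p. c \<in> L"
    by (rule AE_prob_1)
  then show ?thesis
    by eventually_elim (auto simp: L_def)
qed

theorem proposition7p2:
  "p0 \<in> {0<..<1} \<and>
   (\<forall>p\<in>{0..1}. p < p0 \<longrightarrow> (AE c in cost_law p. \<exists>y. zero_path c y))"
proof (intro conjI ballI impI)
  let ?S = "{p \<in> {0..1}. \<P>(c in cost_law p. \<exists>y. zero_path c y) > 0}"
  have small: "(1 / 864)\<^sup>2 \<in> ?S"
    using zero_path_pos_small by (simp add: power2_eq_square)
  \<comment> \<open>Yields both \<open>p0 \<le> 1 / 2\<close> and the boundedness of
    \<open>?S\<close> that makes its supremum meaningful.\<close>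
  have half: "p \<le> 1 / 2" if "p \<in> ?S" for p
    using no_zero_path_if_gt_half[of p] that by (cases "p \<le> 1 / 2") auto
  have bdd: "bdd_above ?S"
    using half by (rule bdd_aboveI)
  have "(1 / 864)\<^sup>2 \<le> p0"
    unfolding p0_def by (rule cSup_upper[OF small bdd])
  then have "0 < p0"
    by (rule less_le_trans[rotated]) simp
  moreover have "p0 \<le> 1 / 2"
    unfolding p0_def using small half by (intro cSup_least) blast+
  ultimately show "p0 \<in> {0<..<1}"
    by simp
  fix p :: real
  assume p: "p \<in> {0..1}" and "p < p0"
  \<comment> \<open>Below the supremum there is a larger \<open>q\<close> with positive probability,
    which monotonicity carries down to \<open>p\<close>.\<close>
  then obtain q where q: "q \<in> ?S" "p < q"
    unfolding p0_def using small by (metis (lifting) less_cSupE empty_iff)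
  have "\<P>(c in cost_law q. \<exists>y. zero_path c y) \<le> \<P>(c in cost_law p. \<exists>y. zero_path c y)"
    using p q by (intro prob_zero_path_antimono) auto
  with q(1) show "AE c in cost_law p. \<exists>y. zero_path c y"
    by (intro AE_zero_path) simp
qed

end
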